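(* Let $C$ be a non-degenerate conic (an ellipse, a hyperbola, or a parabola) in the complex plane given by $$c(z)=\overline{a}z^2+pz\overline{z}+a\overline{z}^2+\overline{b}z+b\overline{z}+q=0\qquad (a,b\in\mathbb{C},\ p,q\in\mathbb{R}).$$ If the segment $[-1,1]$ does not intersect $C$, then the point $z\in C$ such that the sum $|z-1|+|z+1|$ is minimal (among points of $C$) is a root of the equation (of formal degree $6$) $$F_4(z)=W_6z^6+W_5z^5+W_4z^4+W_3z^3+W_2z^2+W_1z+W_0=0,$$ where $W_0,\dots,W_6$ are the explicit polynomials in $a,\overline a,b,\overline b,p,q$ written out in the context.
   Context: The coefficients $W_0,\dots,W_6$ of $F_4$ are as follows. $W_6=4\overline{a}(\overline{b}bp-\overline{b}^2a-\overline{a}b^2)(p^2-4\overline{a}a)$. $W_5=-2\Big[bp^5-\overline{b}(a+\overline{a})p^4-b(4\overline{a}q+8\overline{a}a+\overline{b}^2)p^3+\overline{b}\big(8\overline{a}aq+8\overline{a}a^2+(8\overline{a}^2+\overline{b}^2)a-3\overline{a}b^2\big)p^2+4\overline{a}b(4\overline{a}aq+4\overline{a}a^2+4\overline{b}^2a+\overline{a}b^2)p-4a\overline{a}\overline{b}\big(8\overline{a}aq+4\overline{a}a^2+(4\overline{a}^2+3\overline{b}^2)a+3\overline{a}b^2\big)\Big]$. $W_4=-\Big[p^6-\big((4a+4\overline{a})q+a^2+10\overline{a}a-9b^2+\overline{a}^2+\overline{b}^2\big)p^4-2b\overline{b}(2q+11a+\overline{a})p^3+\Big(16\overline{a}aq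^2+4\big(8\overline{a}a^2+(8\overline{a}^2+2\overline{b}^2)a-5\overline{a}b^2\big)q+8\overline{a}a^3+(32\overline{a}^2+14\overline{b}^2)a^2+(-42\overline{a}b^2+8\overline{a}^3+18\overline{b}^2\overline{a})a+(-6\overline{a}^2-5\overline{b}^2)b^2\Big)p^2+2b\overline{b}\big(48\overline{a}aq+44\overline{a}a^2+(4\overline{a}^2+7\overline{b}^2)a+\overline{a}b^2\big)p-64\overline{a}^2a^2q^2-16a^2\overline{a}(4\overline{a}a+4\overline{a}^2+7\overline{b}^2)q-16\overline{a}^2a^4-(32\overline{a}^3+56\overline{b}^2\overline{a})a^3+(24\overline{a}^2b^2-16\overline{a}^4-56\overline{b}^2\overline{a}^2-9\overline{b}^4)a^2+(24\overline{a}^3-6\overline{b}^2\overline{a})b^2a+3\overline{a}^2b^4\Big]$. $W_3=-2\Big[2bp^5-\overline{b}(q+4a)p^4-b\big((14a+2\overline{a})q+2a^2+12\overline{a}a-8b^2+2\overline{a}^2+\overline{b}^2\big)p^3+\overline{b}\big(4aq^2+(20a^2+20\overline{a}a-7b^2)q+4a^3+24\overline{a}a^2+(-24b^2+4\overline{a}^2+3\overline{b}^2)a-\overline{a}b^2\big)p^2+b\Big(32\overline{a}aq^2+\big(56\overline{a}a^2+(8\overline{a}^2+26\overline{b}^2)a-6\overline{a}b^2\big)q+8\overline{a}a^3+(16\overline{a}^2+26\overline{b}^2)a^2+(-18\overline{a}b^2+8\overline{a}^3+2\overline{b}^2\overline{a})a+(-6\overline{a}^2-\overline{b}^2)b^2\Big)p-\overline{b}\Big(80\overline{a}a^2q^2+4a\big(20\overline{a}a^2+(16\overline{a}^2+6\overline{b}^2)a-3\overline{a}b^2\big)q+16\overline{a}a^4+(32\overline{a}^2+12\overline{b}^2)a^3+(-28\overline{a}b^2+16\overline{a}^3+16\overline{b}^2\overline{a})a^2+(-24\overline{a}^2-\overline{b}^2)b^2a-\overline{a}b^4\Big)\Big]$.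 $W_2=2\Big[\big((3a-\overline{a})q-3b^2\big)p^4+b\overline{b}(3q+9a+\overline{a})p^3+\Big(-2(6a^2+2\overline{a}a-b^2)q^2-\big(4a^3+16\overline{a}a^2+(-27b^2-4\overline{a}^2+9\overline{b}^2)a+4\overline{a}b^2\big)q+3(b^2-3\overline{b}^2)a^2+(9\overline{a}b^2-\overline{b}^2\overline{a})a-7b^4+2\overline{a}^2b^2\Big)p^2-b\overline{b}\big(28aq^2+(60a^2-5b^2)q+8a^3+20\overline{a}a^2-(19b^2-12\overline{a}^2)a-5\overline{a}b^2\big)p+32\overline{a}a^2q^3+4a\big(12\overline{a}a^2+(4\overline{a}^2+11\overline{b}^2)a-3\overline{a}b^2\big)q^2+\big(16\overline{a}a^4+(16\overline{a}^2+44\overline{b}^2)a^3+(-32\overline{a}b^2+40\overline{b}^2\overline{a})a^2-(12\overline{a}^2+9\overline{b}^2)b^2a+\overline{a}b^4\big)q+8\overline{b}^2a^4+(-4\overline{a}b^2+20\overline{b}^2\overline{a})a^3+\big(-(4\overline{a}^2+15\overline{b}^2)b^2+12\overline{b}^2\overline{a}^2+3\overline{b}^4\big)a^2+(5\overline{a}b^4-15\overline{b}^2\overline{a}b^2)a+2\overline{a}^2b^4\Big]$. $W_1=2\Big[2b\big(q^2+(3a-\overline{a})q-b^2\big)p^3-\overline{b}\big(8aq^2+(12a^2-4\overline{a}a+b^2)q-6b^2a-2\overline{a}b^2\big)p^2-b\Big(8aq^3+(32a^2-8\overline{a}a-2b^2)q^2+\big(8a^3+8\overline{a}a^2+(-20b^2-2\overline{b}^2)a+2\overline{a}b^2\big)q+(-2b^2+6\overline{b}^2)a^2+(-2\overline{a}b^2+6\overline{b}^2\overline{a})a+3b^4-\overline{b}^2b^2\Big)p+\overline{b}\Big(32a^2q^3+4a(12a^2+4\overline{a}a-3b^2)q^2+\big(16a^4+16\overline{a}a^3+(-32b^2+8\overline{b}^2)a^2-12\overline{a}b^2a+b^4\big)q+(-4b^2+4\overline{b}^2)a^3+(-4\overline{a}b^2+4\overline{b}^2\overline{a})a^2+(5b^4-3\overline{b}^2b^2)a+2\overline{a}b^4\Big)\Big]$.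 $W_0=q^2p^4-2\overline{b}bqp^3+\big(-8aq^3+(-8a^2+2b^2)q^2+(6b^2+2\overline{b}^2)aq-b^4+\overline{b}^2b^2\big)p^2+2b\overline{b}\big(4aq^2+(-4a^2-b^2)q+(b^2-\overline{b}^2)a\big)p+16a^2q^4+8a(4a^2-b^2)q^3+\big(16a^4+(-32b^2+8\overline{b}^2)a^2+b^4\big)q^2-2a\big((4b^2-4\overline{b}^2)a^2-5b^4+3\overline{b}^2b^2\big)q+(b-\overline{b})(b+\overline{b})\big((b^2-\overline{b}^2)a^2-b^4\big)$. *)

theory Defs
  imports "HOL-Analysis.Analysis"
begin

text \<open>Ellipses, hyperbolas and parabolas are given by their focal definitions. A circle is an
  ellipse with coinciding foci; a hyperbola consists of both branches.\<close>

definition is_ellipse :: "complex set \<Rightarrow> bool" where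
  "is_ellipse C \<longleftrightarrow> (\<exists>f g r. dist f g < 2 * r \<and> C = {z. dist z f + dist z g = 2 * r})"

definition is_hyperbola :: "complex set \<Rightarrow> bool" where
  "is_hyperbola C \<longleftrightarrow>
     (\<exists>f g r. 0 < r \<and> 2 * r < dist f g \<and> C = {z. \<bar>dist z f - dist z g\<bar> = 2 * r})"

definition is_parabola :: "complex set \<Rightarrow> bool" where
  "is_parabola C \<longleftrightarrow>
     (\<exists>f L. affine L \<and> aff_dim L = 1 \<and> f \<notin> L \<and> C = {z. dist z f = infdist z L})"

definition nondegenerate_conic :: "complex set \<Rightarrow> bool" where
  "nondegenerate_conic C \<longleftrightarrow> is_ellipse C \<or> is_hyperbola C \<or> is_parabola C"

definition conic_fun :: "complex \<Rightarrow> complex \<Rightarrow> real \<Rightarrow> real \<Rightarrow> complex \<Rightarrow> complex" where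
  "conic_fun a b p q z =
     cnj a * z ^ 2 + of_real p * z * cnj z + a * cnj z ^ 2 + cnj b * z + b * cnj z + of_real q"

definition conic_curve :: "complex \<Rightarrow> complex \<Rightarrow> real \<Rightarrow> real \<Rightarrow> complex set" where
  "conic_curve a b p q = {z. conic_fun a b p q z = 0}"

text \<open>The coefficients are polynomials in six independent complex variables; \<open>F4\<close> below puts the
  conjugates of \<open>a\<close> and \<open>b\<close> for \<open>a'\<close> and \<open>b'\<close>.\<close>

definition W6 :: "complex \<Rightarrow> complex \<Rightarrow> complex \<Rightarrow> complex \<Rightarrow> complex \<Rightarrow> complex \<Rightarrow> complex" where
  "W6 a a' b b' p q =
     4*a'*(b'*b*p - b'^2*a - a'*b^2)*(p^2 - 4*a'*a)"

definition W5 :: "complex \<Rightarrow> complex \<Rightarrow> complex \<Rightarrow> complex \<Rightarrow> complex \<Rightarrow> complex \<Rightarrow> complex" where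
  "W5 a a' b b' p q =
     -2*(b*p^5 - b'*(a + a')*p^4 - b*(4*a'*q + 8*a'*a + b'^2)*p^3 + b'*(8*a'*a*q
     + 8*a'*a^2 + (8*a'^2 + b'^2)*a - 3*a'*b^2)*p^2 + 4*a'*b*(4*a'*a*q + 4*a'*a^2
     + 4*b'^2*a + a'*b^2)*p - 4*a*a'*b'*(8*a'*a*q + 4*a'*a^2 + (4*a'^2 + 3*b'^2)*a
     + 3*a'*b^2))"

definition W4 :: "complex \<Rightarrow> complex \<Rightarrow> complex \<Rightarrow> complex \<Rightarrow> complex \<Rightarrow> complex \<Rightarrow> complex" where
  "W4 a a' b b' p q =
     -(p^6 - ((4*a + 4*a')*q + a^2 + 10*a'*a - 9*b^2 + a'^2 + b'^2)*p^4 - 2*b*b'*(2*q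
     + 11*a + a')*p^3 + (16*a'*a*q^2 + 4*(8*a'*a^2 + (8*a'^2 + 2*b'^2)*a - 5*a'*b^2)*q
     + 8*a'*a^3 + (32*a'^2 + 14*b'^2)*a^2 + (-42*a'*b^2 + 8*a'^3 + 18*b'^2*a')*a
     + (-6*a'^2 - 5*b'^2)*b^2)*p^2 + 2*b*b'*(48*a'*a*q + 44*a'*a^2 + (4*a'^2
     + 7*b'^2)*a + a'*b^2)*p - 64*a'^2*a^2*q^2 - 16*a^2*a'*(4*a'*a + 4*a'^2
     + 7*b'^2)*q - 16*a'^2*a^4 - (32*a'^3 + 56*b'^2*a')*a^3 + (24*a'^2*b^2 - 16*a'^4
     - 56*b'^2*a'^2 - 9*b'^4)*a^2 + (24*a'^3 - 6*b'^2*a')*b^2*a + 3*a'^2*b^4)"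

definition W3 :: "complex \<Rightarrow> complex \<Rightarrow> complex \<Rightarrow> complex \<Rightarrow> complex \<Rightarrow> complex \<Rightarrow> complex" where
  "W3 a a' b b' p q =
     -2*(2*b*p^5 - b'*(q + 4*a)*p^4 - b*((14*a + 2*a')*q + 2*a^2 + 12*a'*a - 8*b^2
     + 2*a'^2 + b'^2)*p^3 + b'*(4*a*q^2 + (20*a^2 + 20*a'*a - 7*b^2)*q + 4*a^3
     + 24*a'*a^2 + (-24*b^2 + 4*a'^2 + 3*b'^2)*a - a'*b^2)*p^2 + b*(32*a'*a*q^2
     + (56*a'*a^2 + (8*a'^2 + 26*b'^2)*a - 6*a'*b^2)*q + 8*a'*a^3 + (16*a'^2
     + 26*b'^2)*a^2 + (-18*a'*b^2 + 8*a'^3 + 2*b'^2*a')*a + (-6*a'^2 - b'^2)*b^2)*p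
     - b'*(80*a'*a^2*q^2 + 4*a*(20*a'*a^2 + (16*a'^2 + 6*b'^2)*a - 3*a'*b^2)*q
     + 16*a'*a^4 + (32*a'^2 + 12*b'^2)*a^3 + (-28*a'*b^2 + 16*a'^3 + 16*b'^2*a')*a^2
     + (-24*a'^2 - b'^2)*b^2*a - a'*b^4))"

definition W2 :: "complex \<Rightarrow> complex \<Rightarrow> complex \<Rightarrow> complex \<Rightarrow> complex \<Rightarrow> complex \<Rightarrow> complex" where
  "W2 a a' b b' p q =
     2*(((3*a - a')*q - 3*b^2)*p^4 + b*b'*(3*q + 9*a + a')*p^3 + (-2*(6*a^2 + 2*a'*a
     - b^2)*q^2 - (4*a^3 + 16*a'*a^2 + (-27*b^2 - 4*a'^2 + 9*b'^2)*a + 4*a'*b^2)*q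
     + 3*(b^2 - 3*b'^2)*a^2 + (9*a'*b^2 - b'^2*a')*a - 7*b^4 + 2*a'^2*b^2)*p^2
     - b*b'*(28*a*q^2 + (60*a^2 - 5*b^2)*q + 8*a^3 + 20*a'*a^2 - (19*b^2 - 12*a'^2)*a
     - 5*a'*b^2)*p + 32*a'*a^2*q^3 + 4*a*(12*a'*a^2 + (4*a'^2 + 11*b'^2)*a
     - 3*a'*b^2)*q^2 + (16*a'*a^4 + (16*a'^2 + 44*b'^2)*a^3 + (-32*a'*b^2
     + 40*b'^2*a')*a^2 - (12*a'^2 + 9*b'^2)*b^2*a + a'*b^4)*q + 8*b'^2*a^4
     + (-4*a'*b^2 + 20*b'^2*a')*a^3 + (-(4*a'^2 + 15*b'^2)*b^2 + 12*b'^2*a'^2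
     + 3*b'^4)*a^2 + (5*a'*b^4 - 15*b'^2*a'*b^2)*a + 2*a'^2*b^4)"

definition W1 :: "complex \<Rightarrow> complex \<Rightarrow> complex \<Rightarrow> complex \<Rightarrow> complex \<Rightarrow> complex \<Rightarrow> complex" where
  "W1 a a' b b' p q =
     2*(2*b*(q^2 + (3*a - a')*q - b^2)*p^3 - b'*(8*a*q^2 + (12*a^2 - 4*a'*a + b^2)*q
     - 6*b^2*a - 2*a'*b^2)*p^2 - b*(8*a*q^3 + (32*a^2 - 8*a'*a - 2*b^2)*q^2 + (8*a^3
     + 8*a'*a^2 + (-20*b^2 - 2*b'^2)*a + 2*a'*b^2)*q + (-2*b^2 + 6*b'^2)*a^2
     + (-2*a'*b^2 + 6*b'^2*a')*a + 3*b^4 - b'^2*b^2)*p + b'*(32*a^2*q^3 + 4*a*(12*a^2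
     + 4*a'*a - 3*b^2)*q^2 + (16*a^4 + 16*a'*a^3 + (-32*b^2 + 8*b'^2)*a^2
     - 12*a'*b^2*a + b^4)*q + (-4*b^2 + 4*b'^2)*a^3 + (-4*a'*b^2 + 4*b'^2*a')*a^2
     + (5*b^4 - 3*b'^2*b^2)*a + 2*a'*b^4))"

definition W0 :: "complex \<Rightarrow> complex \<Rightarrow> complex \<Rightarrow> complex \<Rightarrow> complex \<Rightarrow> complex \<Rightarrow> complex" where
  "W0 a a' b b' p q =
     q^2*p^4 - 2*b'*b*q*p^3 + (-8*a*q^3 + (-8*a^2 + 2*b^2)*q^2 + (6*b^2 + 2*b'^2)*a*q
     - b^4 + b'^2*b^2)*p^2 + 2*b*b'*(4*a*q^2 + (-4*a^2 - b^2)*q + (b^2 - b'^2)*a)*p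
     + 16*a^2*q^4 + 8*a*(4*a^2 - b^2)*q^3 + (16*a^4 + (-32*b^2 + 8*b'^2)*a^2
     + b^4)*q^2 - 2*a*((4*b^2 - 4*b'^2)*a^2 - 5*b^4 + 3*b'^2*b^2)*q + (b - b')*(b
     + b')*((b^2 - b'^2)*a^2 - b^4)"

definition F4 :: "complex \<Rightarrow> complex \<Rightarrow> real \<Rightarrow> real \<Rightarrow> complex \<Rightarrow> complex" where
  "F4 a b p q z =
     (let W = (\<lambda>w. w a (cnj a) b (cnj b) (of_real p) (of_real q))
      in W W6 * z ^ 6 + W W5 * z ^ 5 + W W4 * z ^ 4 + W W3 * z ^ 3 + W W2 * z ^ 2 + W W1 * z + W W0)"

end

theory Submission
  imports Defs
begin

text \<open>Write \<open>w\<close> for the conjugate of \<open>z\<close>. At the minimum the gradient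
  \<open>u = sgn (z - 1) + sgn (z + 1)\<close> of the distance sum is parallel to the normal
  \<open>n = p z + 2 a w + b\<close> of the conic. As \<open>u\<close> does not vanish off the segment, squaring
  \<open>u / cnj u = n / cnj n\<close> gives \<open>(z\<^sup>2 - 1) (cnj n)\<^sup>2 = (w\<^sup>2 - 1) n\<^sup>2\<close>. The equation of
  the conic is quadratic in \<open>w\<close>, and \<open>n\<close> is its derivative in \<open>w\<close>, so on the conic \<open>n\<^sup>2\<close>
  equals the discriminant \<open>D\<close>, which is free of \<open>w\<close>. This makes the tangency condition
  quadratic in \<open>w\<close> too, and \<open>F4\<close> is the resultant of the two quadratics.\<close>

text \<open>Eliminating both constant terms by the common root \<open>w\<close> turns the Bezout
  form of the resultant into \<open>w^2 * E^2 - E * (w^2 * E)\<close> with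
  \<open>E = a * g1 - c1 * g2\<close>. No division occurs, so vanishing leading coefficients need no
  separate case.\<close>

lemma resultant_quadratics_eq_0:
  fixes a :: "'a::comm_ring_1"
  assumes "a * w^2 + c1 * w + c0 = 0" and "g2 * w^2 + g1 * w + g0 = 0"
  shows "(a * g0 - c0 * g2)^2 - (a * g1 - c1 * g2) * (c1 * g0 - c0 * g1) = 0"
proof -
  have c0: "c0 = - (a * w^2) - c1 * w" and g0: "g0 = - (g2 * w^2) - g1 * w"
    using assms by (simp_all add: algebra_simps eq_neg_iff_add_eq_0)
  show ?thesis
    unfolding c0 g0 by (simp add: algebra_simps power2_eq_square)
qed

lemma F4_eq_resultant:
  fixes a b z :: complex and p q :: real
  defines "A \<equiv> cnj a" and "B \<equiv> cnj b" and "P \<equiv> of_real p" and "Q \<equiv> of_real q"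
  defines "c1 \<equiv> P * z + b" and "c0 \<equiv> A * z^2 + B * z + Q"
  defines "D \<equiv> c1^2 - 4 * a * c0"
  defines "g2 \<equiv> (z^2 - 1) * P^2 - D"
    and "g1 \<equiv> 2 * P * (2 * A * z + B) * (z^2 - 1)"
    and "g0 \<equiv> (z^2 - 1) * (2 * A * z + B)^2 + D"
  shows "F4 a b p q z = (a * g0 - c0 * g2)^2 - (a * g1 - c1 * g2) * (c1 * g0 - c0 * g1)"
  \<comment> \<open>Once the conjugates are folded into \<open>A\<close> and \<open>B\<close>, a
    polynomial identity in independent variables remains.\<close>
  unfolding F4_def Let_def W0_def W1_def W2_def W3_def W4_def W5_def W6_def
    g0_def g1_def g2_def D_def c0_def c1_def
    A_def[symmetric] B_def[symmetric] P_def[symmetric] Q_def[symmetric]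
  by algebra

lemma F4_eq_0_if_tangency:
  assumes c: "conic_fun a b p q z = 0"
    and n: "n = of_real p * z + 2 * a * cnj z + b"
    and G: "n^2 * (cnj z^2 - 1) = (z^2 - 1) * cnj n^2"
  shows "F4 a b p q z = 0"
proof -
  define c1 where "c1 = of_real p * z + b"
  define c0 where "c0 = cnj a * z^2 + cnj b * z + of_real q"
  define D where "D = c1^2 - 4 * a * c0"
  have c': "a * cnj z^2 + c1 * cnj z + c0 = 0"
    using c by (simp add: conic_fun_def c1_def c0_def algebra_simps)
  have "n^2 = 4 * a * (a * cnj z^2 + c1 * cnj z + c0) + D"
    by (simp add: n c1_def D_def algebra_simps power2_eq_square)
  then have "n^2 = D"
    using c' by simp
  moreover have "cnj n = of_real p * cnj z + (2 * cnj a * z + cnj b)"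
    by (simp add: n)
  ultimately have "D * (cnj z^2 - 1) = (z^2 - 1) * (of_real p * cnj z + (2 * cnj a * z + cnj b))^2"
    using G by simp
  \<comment> \<open>Sorted by powers of \<open>cnj z\<close>, the coefficients are
    \<open>g2\<close>, \<open>g1\<close>, \<open>g0\<close> of
    \<open>F4_eq_resultant\<close>.\<close>
  then have "((z^2 - 1) * of_real p^2 - D) * cnj z^2
      + (2 * of_real p * (2 * cnj a * z + cnj b) * (z^2 - 1)) * cnj z
      + ((z^2 - 1) * (2 * cnj a * z + cnj b)^2 + D) = 0"
    by algebra
  from resultant_quadratics_eq_0[OF c' this]
  show ?thesis
    unfolding F4_eq_resultant D_def c1_def c0_def .
qed

text \<open>Exact Taylor expansion: \<open>2 * n\<close> is the gradient, and the increment is real,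
  so that real analysis applies to it.\<close>

lemma conic_fun_add:
  assumes "n = of_real p * z + 2 * a * cnj z + b"
  shows "conic_fun a b p q (z + h) = conic_fun a b p q z
    + of_real (2 * Re (cnj n * h) + (2 * Re (cnj a * h^2) + p * (cmod h)^2))"
proof -
  have "complex_of_real (2 * Re (cnj n * h)) = cnj n * h + n * cnj h"
    using complex_add_cnj[of "cnj n * h"] by simp
  moreover have "complex_of_real (2 * Re (cnj a * h^2)) = cnj a * h^2 + a * cnj h^2"
    using complex_add_cnj[of "cnj a * h^2"] by simp
  moreover have "complex_of_real (p * (cmod h)^2) = of_real p * (h * cnj h)"
    by (simp only: of_real_mult complex_norm_square)
  ultimately show ?thesis
    by (simp only: of_real_add) (simp add: assms conic_fun_def algebra_simps power2_eq_square)
qed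

text \<open>Off the tangent direction the linear term \<open>2 s |n|\<^sup>2\<close> beats the quadratic ones at
  \<open>s = \<plusminus> M t\<^sup>2\<close>, so the intermediate value theorem replaces the implicit function theorem.\<close>

lemma conic_near_tangent:
  assumes c: "conic_fun a b p q z = 0"
    and n: "n = of_real p * z + 2 * a * cnj z + b"
    and M: "M = 2 * cmod a + \<bar>p\<bar>"
    and t: "\<bar>t\<bar> < 1 / (M + 1)"
  shows "\<exists>s. \<bar>s\<bar> \<le> M * t^2 \<and> conic_fun a b p q (z + Complex s t * n) = 0"
proof -
  define N where "N = (cmod n)^2"
  define k where "k = (\<lambda>h. 2 * Re (cnj a * h^2) + p * (cmod h)^2)"
  \<comment> \<open>\<open>Complex s t * n\<close> moves by \<open>s\<close> along the normal
    \<open>n\<close> and by \<open>t\<close> along the tangent \<open>\<i> * n\<close>.\<close>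
  define f where "f = (\<lambda>s. 2 * s * N + k (Complex s t * n))"
  have "M \<ge> 0" "N \<ge> 0"
    by (auto simp: M N_def)
  have k: "\<bar>k h\<bar> \<le> M * (cmod h)^2" for h
  proof -
    have "\<bar>k h\<bar> \<le> 2 * \<bar>Re (cnj a * h^2)\<bar> + \<bar>p * (cmod h)^2\<bar>"
      unfolding k_def by linarith
    also have "\<dots> \<le> 2 * cmod (cnj a * h^2) + \<bar>p * (cmod h)^2\<bar>"
      using abs_Re_le_cmod[of "cnj a * h^2"] by linarith
    also have "\<dots> = M * (cmod h)^2"
      by (simp add: M norm_mult norm_power abs_mult algebra_simps)
    finally show ?thesis .
  qed
  have kf: "\<bar>k (Complex s t * n)\<bar> \<le> M * (s^2 + t^2) * N" for s
    using k[of "Complex s t * n"] by (simp add: norm_mult power_mult_distrib N_def cmod_power2 mult.assoc)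
  have f: "conic_fun a b p q (z + Complex s t * n) = of_real (f s)" for s
  proof -
    have "Re (cnj n * (Complex s t * n)) = s * N"
      unfolding N_def cmod_power2 by (simp add: power2_eq_square algebra_simps)
    then show ?thesis
      using conic_fun_add[OF n, of q "Complex s t * n"] c by (simp add: f_def k_def)
  qed
  \<comment> \<open>Smallness of \<open>t\<close> enters here: at \<open>s = M * t^2\<close> it
    gives \<open>s^2 \<le> t^2\<close>, so the bound \<open>M * (s^2 + t^2) * N\<close> is at most
    \<open>2 * s * N\<close>.\<close>
  have "(M * \<bar>t\<bar>)^2 \<le> 1^2"
  proof (rule power_mono)
    have "(M + 1) * \<bar>t\<bar> \<le> 1"
      using t \<open>M \<ge> 0\<close> by (simp add: field_simps)
    then show "M * \<bar>t\<bar> \<le> 1"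
      by (simp add: algebra_simps)
  qed (use \<open>M \<ge> 0\<close> in auto)
  then have "M * t^2 * (M * \<bar>t\<bar>)^2 \<le> M * t^2 * 1"
    using \<open>M \<ge> 0\<close> by (intro mult_left_mono) auto
  then have "M * ((M * t^2)^2 + t^2) \<le> 2 * (M * t^2)"
    by (simp add: algebra_simps power2_eq_square)
  then have bd: "M * ((M * t^2)^2 + t^2) * N \<le> 2 * (M * t^2) * N"
    using \<open>N \<ge> 0\<close> by (rule mult_right_mono)
  have "f (- (M * t^2)) \<le> 0"
    using kf[of "- (M * t^2)"] bd unfolding f_def by (simp add: abs_le_iff)
  moreover have "0 \<le> f (M * t^2)"
    using kf[of "M * t^2"] bd unfolding f_def by (simp add: abs_le_iff)
  moreover have "- (M * t^2) \<le> M * t^2"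
    using \<open>M \<ge> 0\<close> by simp
  moreover have "continuous_on {- (M * t^2)..M * t^2} f"
    unfolding f_def k_def Complex_eq by (intro continuous_intros)
  ultimately obtain s where "- (M * t^2) \<le> s" "s \<le> M * t^2" "f s = 0"
    using IVT'[of f "- (M * t^2)" 0 "M * t^2"] by auto
  then show ?thesis
    using f[of s] by (intro exI[of _ s]) auto
qed

text \<open>The normal offset \<open>s t\<close> is chosen for each \<open>t\<close> separately,
  without continuity. Its quadratic bound alone forces \<open>s t / t\<close> to 0, which settles
  the derivative at 0.\<close>

lemma conic_tangent_curve:
  assumes "conic_fun a b p q z = 0"
    and "n = of_real p * z + 2 * a * cnj z + b"
  obtains g d where "g 0 = z" and "(g has_vector_derivative \<i> * n) (at 0)" and "0 < d"
    and "\<And>t. \<bar>t\<bar> < d \<Longrightarrow> g t \<in> conic_curve a b p q"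
proof -
  define M where "M = 2 * cmod a + \<bar>p\<bar>"
  have "M \<ge> 0"
    by (simp add: M_def)
  define d where "d = 1 / (M + 1)"
  have "d > 0"
    using \<open>M \<ge> 0\<close> by (simp add: d_def)
  obtain s where s: "\<And>t. \<bar>t\<bar> < d \<Longrightarrow>
      \<bar>s t\<bar> \<le> M * t^2 \<and> conic_fun a b p q (z + Complex (s t) t * n) = 0"
    using conic_near_tangent[OF assms M_def] unfolding d_def by metis
  have "s 0 = 0"
    using s[of 0] \<open>d > 0\<close> by simp
  have "(\<lambda>t. s t / t) \<midarrow>0\<rightarrow> 0"
  proof (rule Lim_null_comparison)
    have "\<forall>\<^sub>F t in at 0. \<bar>t\<bar> < d \<and> t \<noteq> 0"
      using \<open>d > 0\<close> by (auto simp: eventually_at dist_real_def)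
    then show "\<forall>\<^sub>F t in at 0. norm (s t / t) \<le> M * \<bar>t\<bar>"
    proof eventually_elim
      case (elim t)
      then show ?case
        using s[of t] by (simp add: divide_le_eq power2_eq_square mult.assoc)
    qed
    show "(\<lambda>t. M * \<bar>t\<bar>) \<midarrow>0\<rightarrow> 0"
      by (intro tendsto_eq_intros) auto
  qed
  then have "(s has_real_derivative 0) (at 0)"
    by (simp add: DERIV_def \<open>s 0 = 0\<close>)
  then have "((\<lambda>t. z + (of_real (s t) + \<i> * of_real t) * n) has_vector_derivative \<i> * n) (at 0)"
    by (auto intro!: derivative_eq_intros)
  then have "((\<lambda>t. z + Complex (s t) t * n) has_vector_derivative \<i> * n) (at 0)"
    by (simp add: Complex_eq)
  with \<open>d > 0\<close> \<open>s 0 = 0\<close> s show thesis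
    by (intro that[of "\<lambda>t. z + Complex (s t) t * n" d]) (auto simp: conic_curve_def Complex_eq)
qed

lemma DERIV_cmod_diff:
  assumes "(g has_vector_derivative v) (at t)" and "g t \<noteq> w"
  shows "((\<lambda>t. cmod (g t - w)) has_real_derivative Re (cnj (sgn (g t - w)) * v)) (at t)"
proof -
  have "((\<lambda>t. g t - w) has_derivative (\<lambda>x. x *\<^sub>R v)) (at t)"
    using assms(1) unfolding has_vector_derivative_def by (auto intro!: derivative_eq_intros)
  then have "((\<lambda>t. cmod (g t - w)) has_derivative (\<lambda>x. (x *\<^sub>R v) \<bullet> sgn (g t - w))) (at t)"
    by (rule has_derivative_compose[OF _ has_derivative_norm]) (use assms(2) in simp)
  moreover have "(\<lambda>x. (x *\<^sub>R v) \<bullet> u) = (*) (Re (cnj u * v))" for u :: complex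
    by (auto simp: inner_complex_def algebra_simps)
  ultimately show ?thesis
    by (simp only: has_field_derivative_def)
qed

text \<open>Away from the endpoints, the unit vectors from 1 and -1 to \<open>z\<close> are
  opposite; clearing denominators makes \<open>z\<close> a convex combination weighted by the two
  distances.\<close>

lemma in_segment_if_sgn_add_eq_0:
  fixes z :: complex
  assumes "sgn (z - 1) + sgn (z + 1) = 0"
  shows "z \<in> closed_segment (-1) 1"
proof (cases "z = 1 \<or> z = -1")
  case True
  then show ?thesis by auto
next
  case False
  define r1 r2 where "r1 = cmod (z - 1)" and "r2 = cmod (z + 1)"
  have r: "r1 > 0" "r2 > 0"
    using False by (auto simp: r1_def r2_def simp flip: eq_neg_iff_add_eq_0)
  have "(z - 1) / of_real r1 + (z + 1) / of_real r2 = 0"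
    using assms by (simp add: sgn_eq r1_def r2_def)
  then have "z * of_real (r1 + r2) = of_real (r2 - r1)"
    using r by (simp add: field_simps)
  then have "z = of_real ((r2 - r1) / (r1 + r2))"
    using r by (simp add: field_simps flip: of_real_add)
  also have "\<dots> = (1 - r2 / (r1 + r2)) *\<^sub>R (-1) + (r2 / (r1 + r2)) *\<^sub>R 1"
    using r by (simp add: scaleR_conv_of_real field_simps flip: of_real_add)
  finally show ?thesis
    using r unfolding in_segment by (intro exI[of _ "r2 / (r1 + r2)"]) auto
qed

text \<open>Division-free form of \<open>sgn z ^ 2 = z / cnj z\<close>, valid at 0 as well.\<close>

lemma sgn_power2_mult_cnj:
  fixes z :: complex
  shows "sgn z ^ 2 * cnj z = z"
proof (cases "z = 0")
  case False
  have "sgn z ^ 2 * cnj z = z * (z * cnj z) / of_real ((cmod z)^2)"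
    by (simp add: sgn_eq power2_eq_square)
  also have "\<dots> = z"
    unfolding complex_norm_square using False by simp
  finally show ?thesis .
qed simp

text \<open>Unit vectors satisfy \<open>u + v = u * v * cnj (u + v)\<close>, and real multiples of
  \<open>u + v\<close> inherit this, whence \<open>n = u * v * cnj n\<close>. Squaring leaves only
  \<open>u^2\<close> and \<open>v^2\<close>, which are free of square roots.\<close>

lemma parallel_sgn_add:
  assumes "sgn (z - 1) + sgn (z + 1) \<noteq> 0"
    and "z \<noteq> 1" and "z \<noteq> -1"
    and "Im (cnj (sgn (z - 1) + sgn (z + 1)) * n) = 0"
  shows "n^2 * (cnj z^2 - 1) = (z^2 - 1) * cnj n^2"
proof -
  define u v where "u = sgn (z - 1)" and "v = sgn (z + 1)"
  have uv: "u * cnj u = 1" "v * cnj v = 1"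
    using assms(2,3) unfolding complex_norm_square[symmetric] u_def v_def
    by (simp_all add: norm_sgn eq_neg_iff_add_eq_0)
  have uz: "u^2 * cnj (z - 1) = z - 1" and vz: "v^2 * cnj (z + 1) = z + 1"
    unfolding u_def v_def by (rule sgn_power2_mult_cnj)+
  have "cnj (cnj (u + v) * n) = cnj (u + v) * n"
    using assms(4) unfolding u_def v_def Reals_cnj_iff[symmetric] complex_is_Real_iff .
  then have eq: "(u + v) * cnj n = (cnj u + cnj v) * n"
    by simp
  have "(u + v) * (u * v * cnj n) = u * v * ((cnj u + cnj v) * n)"
    unfolding eq[symmetric] by (simp add: ac_simps)
  also have "\<dots> = (u * cnj u * v + v * cnj v * u) * n"
    by (simp add: algebra_simps)
  also have "\<dots> = (u + v) * n"
    by (simp add: uv algebra_simps)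
  finally have n: "n = u * v * cnj n"
    using assms(1) by (simp add: u_def v_def)
  have "n^2 * (cnj z^2 - 1) = (u * v * cnj n)^2 * (cnj (z - 1) * cnj (z + 1))"
    using n by (simp add: algebra_simps power2_eq_square)
  also have "\<dots> = (u^2 * cnj (z - 1)) * (v^2 * cnj (z + 1)) * cnj n^2"
    by (simp only: power_mult_distrib ac_simps)
  also have "\<dots> = (z^2 - 1) * cnj n^2"
    unfolding uz vz by (simp add: algebra_simps power2_eq_square)
  finally show ?thesis .
qed

theorem theorem4p11:
  fixes a b z :: complex and p q :: real
  assumes "nondegenerate_conic (conic_curve a b p q)"
    and "closed_segment (-1) 1 \<inter> conic_curve a b p q = {}"
    and "z \<in> conic_curve a b p q"
    and "\<And>w. w \<in> conic_curve a b p q \<Longrightarrow> cmod (z - 1) + cmod (z + 1) \<le> cmod (w - 1) + cmod (w + 1)"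
  shows "F4 a b p q z = 0"
proof -
  define n where "n = of_real p * z + 2 * a * cnj z + b"
  have c: "conic_fun a b p q z = 0"
    using assms(3) by (simp add: conic_curve_def)
  have seg: "z \<notin> closed_segment (-1) 1"
    using assms(2,3) by blast
  then have z: "z \<noteq> 1" "z \<noteq> -1"
    by auto
  obtain g d where g: "g 0 = z" "(g has_vector_derivative \<i> * n) (at 0)" "0 < d"
    and gc: "\<And>t. \<bar>t\<bar> < d \<Longrightarrow> g t \<in> conic_curve a b p q"
    using conic_tangent_curve[OF c n_def] by blast
  define u where "u = sgn (z - 1) + sgn (z + 1)"
  have "((\<lambda>t. cmod (g t - 1) + cmod (g t - (-1))) has_real_derivative
      Re (cnj (sgn (g 0 - 1)) * (\<i> * n)) + Re (cnj (sgn (g 0 - (-1))) * (\<i> * n))) (at 0)"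
    using g z by (intro DERIV_add DERIV_cmod_diff) auto
  then have "Re (cnj (sgn (g 0 - 1)) * (\<i> * n)) + Re (cnj (sgn (g 0 - (-1))) * (\<i> * n)) = 0"
    by (rule DERIV_local_min[OF _ \<open>0 < d\<close>]) (use assms(4)[OF gc] g(1) in auto)
  \<comment> \<open>The velocity is \<open>\<i> * n\<close>, and
    \<open>Re (cnj u * (\<i> * n)) = - Im (cnj u * n)\<close>: criticality along the tangent makes
    \<open>u\<close> parallel to \<open>n\<close>.\<close>
  then have "Im (cnj u * n) = 0"
    using g(1) by (simp add: u_def algebra_simps)
  moreover have "u \<noteq> 0"
    using in_segment_if_sgn_add_eq_0 seg unfolding u_def by blast
  ultimately have "n^2 * (cnj z^2 - 1) = (z^2 - 1) * cnj n^2"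
    unfolding u_def using z by (intro parallel_sgn_add)
  then show ?thesis
    by (rule F4_eq_0_if_tangency[OF c n_def])
qed

end
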